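(* If $P \in \mathcal{H}_n$, then $P \preccurlyeq D_\lambda P$ for every $\lambda \in \mathbb{R}$.
   Context: $\mathcal{H}_n$ denotes the set of monic hyperbolic polynomials of degree $n$, i.e. monic polynomials of degree $n$ all of whose zeros are real. For a polynomial $P$ of degree $n$, $Z(P)$ is the unordered $n$-tuple of its zeros, each repeated according to multiplicity. For two unordered $n$-tuples $X=(x_1,\dots,x_n)$ and $Y=(y_1,\dots,y_n)$ of real numbers, $X \prec Y$ ($X$ is majorized by $Y$, or less than $Y$ in the spectral order) means that $\sum_{i=1}^n f(x_i) \le \sum_{i=1}^n f(y_i)$ for every convex function $f:\mathbb{R}\to\mathbb{R}$; equivalently, there is a doubly stochastic $n\times n$ matrix $A$ with $(x_1,\dots,x_n)^t = A (y_1,\dots,y_n)^t$. For $P,Q\in\mathcal{H}_n$, $P \preccurlyeq Q$ means $Z(P) \prec Z(Q)$. For $\lambda\in\mathbb{R}$, $D_\lambda = \left(1-\lambda\frac{d}{dx}\right)e^{\lambda\frac{d}{dx}}$, that is, $(D_\lambda P)(x) = P(x+\lambda) - \lambda P'(x+\lambda)$. By the Hermite–Poulain theorem, $D_\lambda$ maps $\mathcal{H}_n$ into $\mathcal{H}_n$. *)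

theory Defs
  imports "HOL-Analysis.Analysis" "HOL-Computational_Algebra.Computational_Algebra"
begin

definition monic_hyperbolic :: "nat \<Rightarrow> real poly set" where
  "monic_hyperbolic n = {P. degree P = n \<and> lead_coeff P = 1 \<and>
     (\<forall>z::complex. poly (map_poly complex_of_real P) z = 0 \<longrightarrow> z \<in> \<real>)}"

text \<open>Unordered tuples are multisets; two of them are comparable only if they have the
  same number of entries.\<close>

definition majorized :: "real multiset \<Rightarrow> real multiset \<Rightarrow> bool" where
  "majorized X Y \<longleftrightarrow> size X = size Y \<and>
     (\<forall>f :: real \<Rightarrow> real. convex_on UNIV f \<longrightarrow> (\<Sum>x\<in>#X. f x) \<le> (\<Sum>y\<in>#Y. f y))"

text \<open>\<^const>\<open>proots\<close> is the multiset of real zeros, counted with multiplicity. On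
  \<^const>\<open>monic_hyperbolic\<close> these are all the zeros.\<close>

definition spectral_le :: "real poly \<Rightarrow> real poly \<Rightarrow> bool" (infix \<open>\<preceq>\<^sub>s\<close> 50) where
  "P \<preceq>\<^sub>s Q \<longleftrightarrow> majorized (proots P) (proots Q)"

text \<open>By Taylor's formula, exp (lam d/dx) is translation of the argument by lam.\<close>

definition shift_poly :: "real \<Rightarrow> real poly \<Rightarrow> real poly" where
  "shift_poly lam P = pcompose P [:lam, 1:]"

definition D_op :: "real \<Rightarrow> real poly \<Rightarrow> real poly" where
  "D_op lam P = shift_poly lam P - smult lam (pderiv (shift_poly lam P))"

lemma poly_D_op:
  "poly (D_op lam P) x = poly P (x + lam) - lam * poly (pderiv P) (x + lam)"
  by (simp add: D_op_def shift_poly_def pderiv_pcompose poly_pcompose pderiv_pCons algebra_simps)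

end

theory Submission
  imports Defs "Jordan_Normal_Form.Schur_Decomposition"
begin

text \<open>
  The zeros \<open>x\<^sub>1, \<dots>, x\<^sub>n\<close> of \<open>P\<close> are the diagonal of a real symmetric matrix whose eigenvalues
  are the zeros of \<open>D_op lam P\<close>, and the diagonal of a symmetric matrix is majorized by its
  spectrum.

  The matrix is \<open>A = diag(x\<^sub>1, \<dots>, x\<^sub>n) + lam (J - I)\<close>, where \<open>J\<close> is the matrix of ones: its
  diagonal entries are the \<open>x\<^sub>i\<close> and all its other entries are \<open>lam\<close>. With \<open>s = t + lam\<close>, the matrix
  \<open>t I - A = diag(s - x\<^sub>i) - lam J\<close> is a rank one perturbation of a diagonal matrix, so the
  matrix determinant lemma (\<open>det_diag_minus_const\<close>) gives
  \<open>det (t I - A) = \<Prod>\<^sub>i (s - x\<^sub>i) (1 - lam \<Sum>\<^sub>i 1 / (s - x\<^sub>i)) = P(s) - lam P'(s)\<close>, which is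
  \<open>D_op lam P\<close> at \<open>t\<close>. That is \<open>char_poly_diag_plus_const\<close>. In particular, the zeros of
  \<open>D_op lam P\<close> are real because \<open>A\<close> is symmetric.

  The comparison of diagonal and spectrum is Schur's theorem
  (\<open>diagonal_majorized_by_eigenvalues\<close>). By the spectral theorem (\<open>real_spectral_theorem\<close>),
  \<open>A = U diag(z) U\<^sup>T\<close> with \<open>U\<close> orthogonal, hence \<open>x\<^sub>i = \<Sum>\<^sub>j U\<^sub>i\<^sub>j\<^sup>2 z\<^sub>j\<close>. The matrix of the squares
  \<open>U\<^sub>i\<^sub>j\<^sup>2\<close> is doubly stochastic, since the rows and the columns of \<open>U\<close> are unit vectors, and
  Jensen's inequality applied to each row concludes.
\<close>

unbundle no inner_syntax
unbundle no vec_syntax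

section \<open>Orthogonal diagonalisation of real symmetric matrices\<close>

text \<open>
  The characteristic polynomial has a complex zero \<open>c\<close>. For an eigenvector \<open>v\<close> the Hermitian
  form \<open>v\<^sup>* A v = c v\<^sup>* v\<close> is real by symmetry of \<open>A\<close>, and so is \<open>v\<^sup>* v \<noteq> 0\<close>; hence \<open>c\<close> is real.
\<close>

lemma symmetric_real_eigenvalue_exists:
  fixes A :: "real mat"
  assumes A: "A \<in> carrier_mat n n" and sym: "A\<^sup>T = A" and n: "n \<noteq> 0"
  shows "\<exists>e. eigenvalue A e"
proof -
  define C where "C = map_mat complex_of_real A"
  have C: "C \<in> carrier_mat n n" using A by (simp add: C_def)
  have "degree (char_poly C) = n" using degree_monic_char_poly[OF C] by simp
  with n obtain c where root: "poly (char_poly C) c = 0"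
    using alg_closed_imp_poly_has_root[of "char_poly C"] by auto
  then have "eigenvalue C c" using eigenvalue_root_char_poly[OF C] by simp
  then obtain v where v: "v \<in> carrier_vec n" "v \<noteq> 0\<^sub>v n" "C *\<^sub>v v = c \<cdot>\<^sub>v v"
    using C unfolding eigenvalue_def eigenvector_def by auto
  define s where "s = (\<Sum>i<n. \<Sum>j<n. complex_of_real (A $$ (i,j)) * (v $ j * cnj (v $ i)))"
  have A_sym: "A $$ (i,j) = A $$ (j,i)" if "i < n" "j < n" for i j
    using that A sym by (metis carrier_matD index_transpose_mat(1))
  have "cnj s = (\<Sum>i<n. \<Sum>j<n. complex_of_real (A $$ (j,i)) * (v $ i * cnj (v $ j)))"
    unfolding s_def by (auto simp: A_sym mult_ac intro!: sum.cong)
  also have "\<dots> = s" unfolding s_def by (rule sum.swap)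
  finally have s_real: "cnj s = s" .
  have s_row: "(\<Sum>j<n. complex_of_real (A $$ (i,j)) * v $ j) = c * v $ i" if "i < n" for i
  proof -
    have "(C *\<^sub>v v) $ i = c * v $ i" using v that by simp
    then show ?thesis using that C v A
      by (simp add: C_def scalar_prod_def row_def lessThan_atLeast0)
  qed
  have "s = (\<Sum>i<n. (\<Sum>j<n. complex_of_real (A $$ (i,j)) * v $ j) * cnj (v $ i))"
    unfolding s_def by (simp add: sum_distrib_right mult.assoc)
  also have "\<dots> = c * (\<Sum>i<n. v $ i * cnj (v $ i))"
    by (simp add: s_row sum_distrib_left mult.assoc)
  also have "(\<Sum>i<n. v $ i * cnj (v $ i)) = v \<bullet>c v"
    using v by (simp add: scalar_prod_def lessThan_atLeast0)
  finally have s_eq: "s = c * (v \<bullet>c v)" .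
  have norm_real: "cnj (v \<bullet>c v) = v \<bullet>c v"
    using v by (simp add: scalar_prod_def mult.commute)
  have "v \<bullet>c v \<noteq> 0" using conjugate_square_eq_0_vec[OF v(1)] v(2) by simp
  with s_real s_eq norm_real have "cnj c = c" by auto
  then obtain r where "c = complex_of_real r"
    by (metis Reals_cases Reals_cnj_iff)
  with root have "complex_of_real (poly (char_poly A) r) = 0"
    unfolding C_def by (simp add: of_real_hom.char_poly_hom[OF A])
  then have "eigenvalue A r" using eigenvalue_root_char_poly[OF A] by simp
  then show ?thesis ..
qed

text \<open>
  Complete \<open>v\<close> to a basis, orthogonalise it by Gram-Schmidt, which keeps the first vector, and
  normalise. The normalisation matters: the inverse of \<open>W\<close> must be its transpose for a conjugation
  by \<open>W\<close> to preserve symmetry.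
\<close>

lemma orthogonal_mat_with_first_col:
  fixes v :: "real vec"
  assumes v: "v \<in> carrier_vec n" and v0: "v \<noteq> 0\<^sub>v n"
  shows "\<exists>W c. W \<in> carrier_mat n n \<and> W\<^sup>T * W = 1\<^sub>m n \<and> col W 0 = c \<cdot>\<^sub>v v"
proof -
  interpret cof_vec_space n "TYPE(real)" .
  have n: "n > 0" using v v0 by (cases n) auto
  define b where "b = basis_completion v"
  define ws where "ws = gram_schmidt n b"
  from basis_completion[OF v v0, folded b_def]
  have dist_b: "distinct b" and indep: "\<not> lin_dep (set b)"
    and b: "set b \<subseteq> carrier_vec n" and hdb: "hd b = v" and len_b: "length b = n" by auto
  from hdb len_b n obtain vs where bv: "b = v # vs" by (cases b) auto
  from gram_schmidt_result[OF b dist_b indep refl, folded ws_def]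
  have ws: "set ws \<subseteq> carrier_vec n" "corthogonal ws" "length ws = n" by (auto simp: len_b)
  have ws_carrier: "ws ! i \<in> carrier_vec n" if "i < n" for i using ws that by auto
  from gram_schmidt_hd[OF v, of vs, folded bv] have "hd ws = v" unfolding ws_def .
  then have ws0: "ws ! 0 = v" using ws n by (cases ws) auto
  define q where "q i = ws ! i \<bullet> ws ! i" for i
  have orth: "ws ! i \<bullet> ws ! j = (if i = j then q i else 0)" "q i \<noteq> 0" if "i < n" "j < n" for i j
    using corthogonalD[OF ws(2), of i j] corthogonalD[OF ws(2), of i i] ws(3) that
    by (auto simp: q_def)
  have q_pos: "q i > 0" if "i < n" for i
  proof -
    have "q i \<ge> 0" unfolding q_def scalar_prod_def by (simp add: sum_nonneg)
    with orth(2)[OF that that] show ?thesis by simp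
  qed
  define W where "W = mat n n (\<lambda>(i,j). ws ! j $ i / sqrt (q j))"
  have W: "W \<in> carrier_mat n n" by (simp add: W_def)
  have "W\<^sup>T * W = 1\<^sub>m n"
  proof (rule eq_matI)
    fix i j assume "i < dim_row (1\<^sub>m n :: real mat)" "j < dim_col (1\<^sub>m n :: real mat)"
    then have ij: "i < n" "j < n" by auto
    have "(W\<^sup>T * W) $$ (i,j) = (\<Sum>k=0..<n. ws ! i $ k * ws ! j $ k) / (sqrt (q i) * sqrt (q j))"
      using ij by (simp add: W_def scalar_prod_def sum_divide_distrib)
    also have "(\<Sum>k=0..<n. ws ! i $ k * ws ! j $ k) = ws ! i \<bullet> ws ! j"
      using ws_carrier[OF ij(2)] by (simp add: scalar_prod_def)
    also have "\<dots> / (sqrt (q i) * sqrt (q j)) = (1\<^sub>m n :: real mat) $$ (i,j)"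
      using ij orth[OF ij] q_pos[OF ij(1)] by auto
    finally show "(W\<^sup>T * W) $$ (i,j) = (1\<^sub>m n :: real mat) $$ (i,j)" .
  qed (use W in auto)
  moreover have "col W 0 = (1 / sqrt (q 0)) \<cdot>\<^sub>v v"
    using n v by (auto simp: W_def ws0 col_def)
  ultimately show ?thesis using W by blast
qed

text \<open>
  Deflation: in an orthonormal basis that starts with an eigenvector, the first column of the
  symmetric matrix is \<open>(e, 0, \<dots>, 0)\<close>; by symmetry so is the first row, and the remaining block is
  symmetric of smaller size.
\<close>

theorem real_spectral_theorem:
  fixes A :: "real mat"
  assumes "A \<in> carrier_mat n n" and "A\<^sup>T = A"
  shows "\<exists>U d. U \<in> carrier_mat n n \<and> U\<^sup>T * U = 1\<^sub>m n \<and> A = U * mat_diag n d * U\<^sup>T"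
  using assms
proof (induction n arbitrary: A)
  case 0
  then show ?case by (intro exI[of _ "1\<^sub>m 0"]) (auto intro!: eq_matI)
next
  case (Suc m)
  note A = Suc.prems(1)
  obtain e where "eigenvalue A e"
    using symmetric_real_eigenvalue_exists[OF A Suc.prems(2)] by auto
  then obtain v where v: "v \<in> carrier_vec (Suc m)" "v \<noteq> 0\<^sub>v (Suc m)" "A *\<^sub>v v = e \<cdot>\<^sub>v v"
    using A unfolding eigenvalue_def eigenvector_def by auto
  obtain W c where W: "W \<in> carrier_mat (Suc m) (Suc m)" and WW: "W\<^sup>T * W = 1\<^sub>m (Suc m)"
    and W0: "col W 0 = c \<cdot>\<^sub>v v"
    using orthogonal_mat_with_first_col[OF v(1,2)] by auto
  have Wt: "W\<^sup>T \<in> carrier_mat (Suc m) (Suc m)" using W by simp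
  have WW': "W * W\<^sup>T = 1\<^sub>m (Suc m)" by (rule mat_mult_left_right_inverse[OF Wt W WW])
  define B where "B = W\<^sup>T * (A * W)"
  have B: "B \<in> carrier_mat (Suc m) (Suc m)" using W A by (simp add: B_def)
  have B_sym: "B\<^sup>T = B"
  proof -
    have "B\<^sup>T = (A * W)\<^sup>T * W\<^sup>T\<^sup>T"
      unfolding B_def by (rule transpose_mult[OF Wt]) (use A W in auto)
    also have "(A * W)\<^sup>T = W\<^sup>T * A" using transpose_mult[OF A W] Suc.prems(2) by simp
    finally show ?thesis unfolding B_def using A W Wt by simp
  qed
  have B_col0: "B $$ (i, 0) = (if i = 0 then e else 0)" if i: "i < Suc m" for i
  proof -
    have "A *\<^sub>v col W 0 = e \<cdot>\<^sub>v col W 0"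
      unfolding W0 using A v by (simp add: mult_mat_vec smult_smult_assoc mult.commute)
    then have "col (A * W) 0 = e \<cdot>\<^sub>v col W 0"
      by (simp only: col_mult2[OF A W zero_less_Suc])
    then have "B $$ (i, 0) = e * (row W\<^sup>T i \<bullet> col W 0)"
      using i A W Wt by (simp add: B_def)
    also have "row W\<^sup>T i \<bullet> col W 0 = (W\<^sup>T * W) $$ (i, 0)"
      using i W Wt by simp
    finally show ?thesis using i by (simp add: WW)
  qed
  have B_row0: "B $$ (0, i) = (if i = 0 then e else 0)" if i: "i < Suc m" for i
    using B_col0[OF i] B_sym B i by (metis carrier_matD index_transpose_mat(1) zero_less_Suc)
  define B' where "B' = mat m m (\<lambda>(i,j). B $$ (Suc i, Suc j))"
  have B': "B' \<in> carrier_mat m m" by (simp add: B'_def)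
  have "B'\<^sup>T = B'"
  proof (rule eq_matI)
    fix i j assume "i < dim_row B'" "j < dim_col B'"
    then have ij: "i < m" "j < m" by (auto simp: B'_def)
    have "B\<^sup>T $$ (Suc i, Suc j) = B $$ (Suc j, Suc i)" using B ij by simp
    then show "B'\<^sup>T $$ (i, j) = B' $$ (i, j)" using ij by (simp add: B'_def B_sym)
  qed (auto simp: B'_def)
  from Suc.IH[OF B' this] obtain V d where V: "V \<in> carrier_mat m m"
    and VV: "V\<^sup>T * V = 1\<^sub>m m" and B'_eq: "B' = V * mat_diag m d * V\<^sup>T" by auto
  define E where "E = mat 1 1 (\<lambda>_. e)"
  \<comment> \<open>Block diagonal matrices multiply and transpose blockwise; this carries the diagonalisation
    of the lower right block over to \<open>B\<close>.\<close>
  define block :: "real mat \<Rightarrow> real mat \<Rightarrow> real mat"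
    where "block X Y = four_block_mat X (0\<^sub>m 1 m) (0\<^sub>m m 1) Y" for X Y
  have block: "block X Y \<in> carrier_mat (Suc m) (Suc m)"
    if "X \<in> carrier_mat 1 1" "Y \<in> carrier_mat m m" for X Y
    using four_block_carrier_mat[OF that] by (simp add: block_def)
  have block_mult: "block X Y * block X' Y' = block (X * X') (Y * Y')"
    if "X \<in> carrier_mat 1 1" "Y \<in> carrier_mat m m" "X' \<in> carrier_mat 1 1" "Y' \<in> carrier_mat m m"
    for X Y X' Y'
    unfolding block_def
    by (subst mult_four_block_mat[of _ 1 1 _ m _ m _ _ 1 _ m]) (use that in auto)
  have block_transpose: "(block X Y)\<^sup>T = block X\<^sup>T Y\<^sup>T"
    if "X \<in> carrier_mat 1 1" "Y \<in> carrier_mat m m" for X Y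
    unfolding block_def
    by (subst transpose_four_block_mat[of _ 1 1 _ m _ m]) (use that in auto)
  have one_block: "block (1\<^sub>m 1) (1\<^sub>m m) = 1\<^sub>m (Suc m)"
    unfolding block_def by (auto intro!: eq_matI)
  have E: "E \<in> carrier_mat 1 1" by (simp add: E_def)
  have D: "mat_diag m d \<in> carrier_mat m m" by simp
  have Vt: "V\<^sup>T \<in> carrier_mat m m" using V by simp
  define F where "F = block (1\<^sub>m 1) V"
  have F: "F \<in> carrier_mat (Suc m) (Suc m)" using V by (simp add: F_def block)
  have Ft: "F\<^sup>T \<in> carrier_mat (Suc m) (Suc m)" using F by simp
  have F_eq: "F\<^sup>T = block (1\<^sub>m 1) V\<^sup>T" using V by (simp add: F_def block_transpose)
  define G where "G = mat_diag (Suc m) (case_nat e d)"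
  have G: "G \<in> carrier_mat (Suc m) (Suc m)" by (simp add: G_def)
  have G_eq: "G = block E (mat_diag m d)"
    unfolding G_def block_def E_def mat_diag_def
    by (rule eq_matI) (auto split: nat.split)
  have B_eq: "B = F * G * F\<^sup>T"
  proof -
    have "B = block E B'"
    proof (rule eq_matI)
      fix i j assume "i < dim_row (block E B')" "j < dim_col (block E B')"
      then have "i < Suc m" "j < Suc m" by (auto simp: block_def E_def B'_def)
      then show "B $$ (i, j) = block E B' $$ (i, j)"
        using B_row0[of j] B_col0[of i]
        by (cases i; cases j) (auto simp: block_def E_def B'_def)
    qed (use B in \<open>auto simp: block_def E_def B'_def\<close>)
    also have "\<dots> = F * G * F\<^sup>T"
      unfolding F_eq G_eq unfolding F_def B'_eq
      using E D V Vt by (simp add: block_mult)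
    finally show ?thesis .
  qed
  have FF: "F\<^sup>T * F = 1\<^sub>m (Suc m)"
    unfolding F_eq unfolding F_def using V Vt
    by (simp add: block_mult VV one_block del: One_nat_def)
  note assoc = assoc_mult_mat[of _ "Suc m" "Suc m" _ "Suc m" _ "Suc m"]
    mult_carrier_mat[of _ "Suc m" "Suc m" _ "Suc m"]
  define U where "U = W * F"
  have U: "U \<in> carrier_mat (Suc m) (Suc m)" using W F by (simp add: U_def)
  have U_t: "U\<^sup>T = F\<^sup>T * W\<^sup>T" unfolding U_def by (rule transpose_mult[OF W F])
  have "U\<^sup>T * U = F\<^sup>T * (W\<^sup>T * W) * F"
    unfolding U_t unfolding U_def using W Wt F Ft by (simp add: assoc)
  then have UU: "U\<^sup>T * U = 1\<^sub>m (Suc m)" using F Ft by (simp add: WW FF)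
  have "A = (W * W\<^sup>T) * A * (W * W\<^sup>T)" using A by (simp add: WW')
  also have "\<dots> = W * B * W\<^sup>T" unfolding B_def using A W Wt by (simp add: assoc)
  also have "\<dots> = U * G * U\<^sup>T"
    unfolding U_t unfolding B_eq U_def using W Wt F Ft G by (simp add: assoc)
  finally show ?case using U UU unfolding G_def by blast
qed

section \<open>Schur's majorization theorem\<close>

lemma majorized_if_doubly_stochastic:
  fixes S :: "nat \<Rightarrow> nat \<Rightarrow> real"
  assumes nonneg: "\<And>i j. i < n \<Longrightarrow> j < n \<Longrightarrow> S i j \<ge> 0"
    and rows: "\<And>i. i < n \<Longrightarrow> (\<Sum>j<n. S i j) = 1"
    and cols: "\<And>j. j < n \<Longrightarrow> (\<Sum>i<n. S i j) = 1"
    and x: "\<And>i. i < n \<Longrightarrow> x i = (\<Sum>j<n. S i j * y j)"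
  shows "majorized (image_mset x (mset_set {..<n})) (image_mset y (mset_set {..<n}))"
proof -
  have "(\<Sum>i<n. f (x i)) \<le> (\<Sum>j<n. f (y j))" if f: "convex_on UNIV f" for f :: "real \<Rightarrow> real"
  proof -
    have "f (x i) \<le> (\<Sum>j<n. S i j * f (y j))" if i: "i < n" for i
    proof -
      have "f (\<Sum>j<n. S i j *\<^sub>R y j) \<le> (\<Sum>j<n. S i j * f (y j))"
        by (rule convex_on_sum[OF _ _ f]) (use i nonneg rows in auto)
      then show ?thesis using x[OF i] by simp
    qed
    then have "(\<Sum>i<n. f (x i)) \<le> (\<Sum>i<n. \<Sum>j<n. S i j * f (y j))"
      by (intro sum_mono) auto
    also have "\<dots> = (\<Sum>j<n. (\<Sum>i<n. S i j) * f (y j))"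
      by (subst sum.swap) (simp add: sum_distrib_right)
    also have "\<dots> = (\<Sum>j<n. f (y j))" by (simp add: cols)
    finally show ?thesis .
  qed
  then show ?thesis
    by (simp add: majorized_def sum_unfold_sum_mset image_mset.compositionality o_def)
qed

lemma proots_prod_linear_factors:
  fixes d :: "nat \<Rightarrow> real"
  shows "proots (\<Prod>i<n. [:- d i, 1:]) = image_mset d (mset_set {..<n})"
proof -
  have "proots (\<Prod>i<n. [:- d i, 1:]) = (\<Sum>i<n. {#d i#})"
    by (subst proots_prod) auto
  also have "\<dots> = image_mset d (mset_set {..<n})"
    by (induction n) (auto simp: lessThan_Suc)
  finally show ?thesis .
qed

theorem diagonal_majorized_by_eigenvalues:
  fixes A :: "real mat"
  assumes A: "A \<in> carrier_mat n n" and sym: "A\<^sup>T = A"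
  shows "majorized (image_mset (\<lambda>i. A $$ (i, i)) (mset_set {..<n})) (proots (char_poly A))"
proof -
  obtain U d where U: "U \<in> carrier_mat n n" and UU: "U\<^sup>T * U = 1\<^sub>m n"
    and A_eq: "A = U * mat_diag n d * U\<^sup>T"
    using real_spectral_theorem[OF A sym] by auto
  have Ut: "U\<^sup>T \<in> carrier_mat n n" using U by simp
  have UU': "U * U\<^sup>T = 1\<^sub>m n" by (rule mat_mult_left_right_inverse[OF Ut U UU])
  have D: "mat_diag n d \<in> carrier_mat n n" by simp
  have "similar_mat_wit A (mat_diag n d) U U\<^sup>T"
    by (rule similar_mat_witI[OF UU' UU A_eq A D U Ut])
  then have "char_poly A = char_poly (mat_diag n d)"
    by (intro char_poly_similar) (auto simp: similar_mat_def)
  also have "\<dots> = (\<Prod>a\<leftarrow>diag_mat (mat_diag n d). [:- a, 1:])"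
    by (rule char_poly_upper_triangular[OF D]) (auto simp: mat_diag_def)
  also have "\<dots> = (\<Prod>i<n. [:- d i, 1:])"
    by (simp add: diag_mat_def mat_diag_def prod.list_conv_set_nth lessThan_atLeast0)
  finally have cp: "proots (char_poly A) = image_mset d (mset_set {..<n})"
    by (simp add: proots_prod_linear_factors)
  have rows: "(\<Sum>j<n. (U $$ (i,j))\<^sup>2) = 1" if i: "i < n" for i
  proof -
    have "(U * U\<^sup>T) $$ (i,i) = (\<Sum>j<n. (U $$ (i,j))\<^sup>2)"
      using i U by (simp add: scalar_prod_def power2_eq_square lessThan_atLeast0)
    then show ?thesis using i by (simp add: UU')
  qed
  have cols: "(\<Sum>i<n. (U $$ (i,j))\<^sup>2) = 1" if j: "j < n" for j
  proof -
    have "(U\<^sup>T * U) $$ (j,j) = (\<Sum>i<n. (U $$ (i,j))\<^sup>2)"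
      using j U by (simp add: scalar_prod_def power2_eq_square lessThan_atLeast0)
    then show ?thesis using j by (simp add: UU)
  qed
  have diag: "A $$ (i,i) = (\<Sum>j<n. (U $$ (i,j))\<^sup>2 * d j)" if i: "i < n" for i
    unfolding A_eq using i U
    by (simp add: mat_diag_mult_right[OF U] scalar_prod_def power2_eq_square lessThan_atLeast0
        mult_ac)
  show ?thesis
    unfolding cp by (rule majorized_if_doubly_stochastic[OF _ rows cols diag]) auto
qed

section \<open>The characteristic polynomial of a diagonal matrix with constant perturbation\<close>

lemma det_mat_diag: "Determinant.det (mat_diag n a) = (\<Prod>i<n. a i)"
proof -
  have "Determinant.det (mat_diag n a) = prod_list (diag_mat (mat_diag n a))"
    by (rule det_upper_triangular[of _ n]) (auto simp: mat_diag_def)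
  also have "\<dots> = (\<Prod>i<n. a i)"
    by (simp add: diag_mat_def mat_diag_def prod.list_conv_set_nth lessThan_atLeast0)
  finally show ?thesis .
qed

text \<open>
  The matrix determinant lemma for a multiple of the matrix of ones. The bordered matrix \<open>N\<close> with
  blocks \<open>diag(a)\<close>, a column of entries \<open>c\<close>, a row of ones and the corner \<open>1\<close> has two
  factorizations into block triangular matrices, one for the Schur complement of each diagonal
  block; their determinants are the two sides.
\<close>

lemma det_diag_minus_const:
  fixes a :: "nat \<Rightarrow> 'a :: field"
  assumes nz: "\<And>i. i < n \<Longrightarrow> a i \<noteq> 0"
  shows "Determinant.det (mat n n (\<lambda>(i,j). (if i = j then a i else 0) - c))
    = (\<Prod>i<n. a i) * (1 - c * (\<Sum>i<n. 1 / a i))"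
proof -
  define M where "M = mat n n (\<lambda>(i,j). (if i = j then a i else 0) - c)"
  define r where "r = 1 - c * (\<Sum>i<n. 1 / a i)"
  define row1 :: "'a mat" where "row1 = mat 1 n (\<lambda>_. 1)"
  define col_c where "col_c = mat n 1 (\<lambda>_. c)"
  define col_ca where "col_ca = mat n 1 (\<lambda>(i,_). c / a i)"
  define N where "N = four_block_mat (mat_diag n a) col_c row1 (1\<^sub>m 1)"
  note defs = M_def row1_def col_c_def col_ca_def mat_diag_def
  have carr: "M \<in> carrier_mat n n" "row1 \<in> carrier_mat 1 n" "col_c \<in> carrier_mat n 1"
    "col_ca \<in> carrier_mat n 1" "mat_diag n a \<in> carrier_mat n n"
    by (auto simp: defs)
  \<comment> \<open>Eliminating the corner leaves \<open>diag(a) - c J = M\<close>.\<close>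
  have "col_c * row1 + M = mat_diag n a"
    by (rule eq_matI) (auto simp: defs scalar_prod_def)
  then have N1: "N = four_block_mat (1\<^sub>m n) col_c (0\<^sub>m 1 n) (1\<^sub>m 1)
      * four_block_mat M (0\<^sub>m n 1) row1 (1\<^sub>m 1)"
    unfolding N_def
    by (subst mult_four_block_mat[of _ n n _ 1 _ 1 _ _ n _ 1])
      (use carr in \<open>auto simp: comm_add_mat[of M n n]\<close>)
  \<comment> \<open>Eliminating \<open>diag(a)\<close> leaves the number \<open>r\<close>.\<close>
  have "mat_diag n a * col_ca = col_c"
    unfolding mat_diag_mult_left[OF carr(4)]
    using nz by (intro eq_matI) (auto simp: col_c_def col_ca_def)
  moreover have "row1 * col_ca + mat 1 1 (\<lambda>_. r) = 1\<^sub>m 1"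
    by (rule eq_matI)
      (auto simp: defs r_def scalar_prod_def sum_distrib_left lessThan_atLeast0)
  ultimately have N2: "N = four_block_mat (mat_diag n a) (0\<^sub>m n 1) row1 (1\<^sub>m 1)
      * four_block_mat (1\<^sub>m n) col_ca (0\<^sub>m 1 n) (mat 1 1 (\<lambda>_. r))"
    unfolding N_def
    by (subst mult_four_block_mat[of _ n n _ 1 _ 1 _ _ n _ 1])
      (use carr in \<open>auto simp: right_mult_one_mat[OF carr(5)] right_add_zero_mat[OF carr(5)]\<close>)
  have "Determinant.det N = Determinant.det (four_block_mat (1\<^sub>m n) col_c (0\<^sub>m 1 n) (1\<^sub>m 1))
      * Determinant.det (four_block_mat M (0\<^sub>m n 1) row1 (1\<^sub>m 1))"
    unfolding N1
    by (rule det_mult[of _ "n + 1"]; rule four_block_carrier_mat) (use carr in auto)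
  also have "\<dots> = Determinant.det M"
    using carr by (simp add: det_four_block_mat_lower_left_zero[of _ n _ 1]
        det_four_block_mat_upper_right_zero[of _ n _ 1] del: One_nat_def)
  finally have "Determinant.det N = Determinant.det M" .
  moreover have "Determinant.det N
      = Determinant.det (four_block_mat (mat_diag n a) (0\<^sub>m n 1) row1 (1\<^sub>m 1))
      * Determinant.det (four_block_mat (1\<^sub>m n) col_ca (0\<^sub>m 1 n) (mat 1 1 (\<lambda>_. r)))"
    unfolding N2
    by (rule det_mult[of _ "n + 1"]; rule four_block_carrier_mat) (use carr in auto)
  moreover have "\<dots> = (\<Prod>i<n. a i) * r"
    using carr by (simp add: det_four_block_mat_lower_left_zero[of _ n _ 1]
        det_four_block_mat_upper_right_zero[of _ n _ 1] det_mat_diag det_single del: One_nat_def)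
  ultimately show ?thesis by (simp add: M_def r_def)
qed

text \<open>
  Away from the points \<open>x i - lam\<close>, where the diagonal matrix in the determinant lemma is singular,
  \<open>P' / P\<close> is the sum of the reciprocals \<open>1 / (t + lam - x i)\<close>. Two polynomials that agree off a
  finite set are equal.
\<close>

lemma char_poly_diag_plus_const:
  fixes x :: "nat \<Rightarrow> real" and lam :: real
  shows "char_poly (mat n n (\<lambda>(i,j). if i = j then x i else lam))
    = D_op lam (\<Prod>i<n. [:- x i, 1:])"
proof -
  define A where "A = mat n n (\<lambda>(i,j). if i = j then x i else lam)"
  define P where "P = (\<Prod>i<n. [:- x i, 1:])"
  have A: "A \<in> carrier_mat n n" by (simp add: A_def)
  have generic: "poly (char_poly A) t = poly (D_op lam P) t"
    if t: "t \<notin> (\<lambda>i. x i - lam) ` {..<n}" for t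
  proof -
    define a where "a i = t + lam - x i" for i
    have nz: "a i \<noteq> 0" if "i < n" for i using t that by (force simp: a_def)
    have "- char_matrix A t = mat n n (\<lambda>(i,j). (if i = j then a i else 0) - lam)"
      by (rule eq_matI) (auto simp: A_def a_def char_matrix_def)
    then have "poly (char_poly A) t = (\<Prod>i<n. a i) * (1 - lam * (\<Sum>i<n. 1 / a i))"
      using char_poly_matrix[OF A, of t] det_diag_minus_const[of n a lam] nz by simp
    moreover have "poly P (t + lam) = (\<Prod>i<n. a i)"
      by (simp add: P_def poly_prod a_def algebra_simps)
    moreover have "poly (pderiv P) (t + lam) = (\<Sum>i<n. \<Prod>j\<in>{..<n} - {i}. a j)"
      by (simp add: P_def pderiv_prod poly_sum poly_prod pderiv_pCons a_def algebra_simps)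
    moreover have "(\<Prod>j\<in>{..<n} - {i}. a j) = (\<Prod>i<n. a i) * (1 / a i)" if "i < n" for i
      using that nz[OF that] by (subst prod.remove[of "{..<n}" i]) auto
    ultimately show ?thesis
      by (simp add: poly_D_op sum_distrib_left algebra_simps)
  qed
  have "char_poly A - D_op lam P = 0"
  proof (rule ccontr)
    assume "char_poly A - D_op lam P \<noteq> 0"
    then have fin: "finite ({t. poly (char_poly A - D_op lam P) t = 0} \<union> (\<lambda>i. x i - lam) ` {..<n})"
      using poly_roots_finite by blast
    have "{t. poly (char_poly A - D_op lam P) t = 0} \<union> (\<lambda>i. x i - lam) ` {..<n} = UNIV"
      using generic by auto
    with fin show False using infinite_UNIV_char_0[where 'a = real] by metis
  qed
  then show ?thesis by (simp add: A_def P_def)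
qed

section \<open>Comparison of zeros\<close>

lemma monic_hyperbolic_factorization:
  assumes "P \<in> monic_hyperbolic n"
  shows "\<exists>x. P = (\<Prod>i<n. [:- x i, 1:])"
proof -
  let ?Q = "map_poly complex_of_real P"
  have deg: "degree P = n" and monic: "lead_coeff P = 1"
    and real: "\<And>z. poly ?Q z = 0 \<Longrightarrow> z \<in> \<real>"
    using assms by (auto simp: monic_hyperbolic_def)
  obtain zs where "Polynomial.smult (lead_coeff ?Q) (\<Prod>a\<leftarrow>zs. [:- a, 1:]) = ?Q"
    and len: "length zs = n"
    using fundamental_theorem_algebra_factorized[of ?Q] deg by auto
  then have Q: "?Q = (\<Prod>i<n. [:- (zs ! i), 1:])"
    using monic deg by (simp add: prod.list_conv_set_nth lessThan_atLeast0 coeff_map_poly)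
  have zs: "zs ! i = complex_of_real (Re (zs ! i))" if i: "i < n" for i
  proof -
    have "poly ?Q (zs ! i) = 0" using i unfolding Q poly_prod by auto
    then show ?thesis using real by auto
  qed
  have "poly P t = poly (\<Prod>i<n. [:- Re (zs ! i), 1:]) t" for t
  proof -
    have "complex_of_real (poly P t) = poly ?Q (complex_of_real t)" by simp
    also have "\<dots> = (\<Prod>i<n. complex_of_real t - zs ! i)"
      unfolding Q by (simp add: poly_prod)
    also have "\<dots> = (\<Prod>i<n. complex_of_real (t - Re (zs ! i)))"
      using zs by (intro prod.cong) auto
    also have "\<dots> = complex_of_real (poly (\<Prod>i<n. [:- Re (zs ! i), 1:]) t)"
      by (simp add: poly_prod)
    finally show ?thesis by (simp only: of_real_eq_iff)
  qed
  then show ?thesis by (metis poly_eq_poly_eq_iff ext)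
qed

theorem theorem3:
  fixes n :: nat and P :: "real poly" and lam :: real
  assumes "P \<in> monic_hyperbolic n"
  shows "P \<preceq>\<^sub>s D_op lam P"
proof -
  obtain x where P: "P = (\<Prod>i<n. [:- x i, 1:])"
    using monic_hyperbolic_factorization[OF assms] by auto
  define A where "A = mat n n (\<lambda>(i,j). if i = j then x i else lam)"
  have A: "A \<in> carrier_mat n n" by (simp add: A_def)
  have sym: "A\<^sup>T = A" by (rule eq_matI) (auto simp: A_def)
  have "image_mset (\<lambda>i. A $$ (i, i)) (mset_set {..<n}) = proots P"
    unfolding P proots_prod_linear_factors by (rule image_mset_cong) (auto simp: A_def)
  moreover have "char_poly A = D_op lam P"
    unfolding A_def P by (rule char_poly_diag_plus_const)
  ultimately show ?thesis
    using diagonal_majorized_by_eigenvalues[OF A sym] by (simp add: spectral_le_def)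
qed

end
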